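(* Given a prior $P\in\mathcal{P}(\Theta)$ (fixed independently of the data), $\delta\in(0,1]$ and $\lambda>0$, the following holds with probability at least $1-\delta$ over the logged data $\mathcal{D}_n$: $$\forall Q\in\mathcal{P}(\Theta),\qquad R(\pi_Q)\le\psi_\lambda\Big(\hat{R}^{\lambda\text{-}\mathrm{LIN}}_n(\pi_Q)+\frac{\mathcal{KL}(Q\|P)+\ln\frac1\delta}{\lambda n}\Big),$$ where $\mathcal{KL}(Q\|P)$ is the Kullback-Leibler divergence from $P$ to $Q$.
   Context: Setting (offline contextual bandit). $\mathcal{X}\subset\mathbb{R}^d$ is a compact context space, $\mathcal{A}=\{1,\dots,K\}=[K]$ a finite action set, $\nu$ a probability distribution on $\mathcal{X}$. A policy $\pi$ assigns to each $x\in\mathcal{X}$ a probability distribution $\pi(\cdot|x)$ on $\mathcal{A}$; $\pi_0$ is a fixed behavior policy. Given $(x,a)$, a cost $c\in[-1,0]$ is drawn from a distribution $p(\cdot|x,a)$, with mean $c(x,a)$. The logged data $\mathcal{D}_n=(x_i,a_i,c_i)_{i\in[n]}$ consists of $n$ i.i.d. tuples with $x_i\sim\nu$, $a_i\sim\pi_0(\cdot|x_i)$, $c_i\sim p(\cdot|x_i,a_i)$ (so $\pi_0(a_i|x_i)>0$ almost surely). The risk of a policy is $R(\pi)=\mathbb{E}_{x\sim\nu,\,a\sim\pi(\cdot|x)}[c(x,a)]$. PAC-Bayesian policies. $\{f_\theta:\mathcal{X}\to[K],\ \theta\in\Theta\}$ is a set of parameterized (measurable) predictors and $\mathcal{P}(\Theta)$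 is the set of probability distributions on $\Theta$. Each $Q\in\mathcal{P}(\Theta)$ defines a policy $\pi_Q(a|x)=\mathbb{E}_{\theta\sim Q}\big[\mathbf{1}[f_\theta(x)=a]\big]$. Notation. $\psi_\lambda(x)=\frac1\lambda(1-e^{-\lambda x})$ for $x\in\mathbb{R}$ (with $\psi_\lambda(+\infty)=1/\lambda$), and $$\hat{R}^{\lambda\text{-}\mathrm{LIN}}_n(\pi)=-\frac1n\sum_{i=1}^n\frac{\pi(a_i|x_i)}{\lambda}\log\Big(1-\frac{\lambda c_i}{\pi_0(a_i|x_i)}\Big).$$ *)

theory Defs
  imports "HOL-Probability.Probability"
begin

abbreviation cost_space :: "real measure" where
  "cost_space \<equiv> restrict_space borel {-1..0}"

text \<open>A policy is given by its conditional mass function: \<open>pol x a\<close> stands for $\pi(a|x)$.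
  The first argument carries the measurable space of contexts.\<close>

definition is_policy :: "'x measure \<Rightarrow> nat \<Rightarrow> ('x \<Rightarrow> nat \<Rightarrow> real) \<Rightarrow> bool" where
  "is_policy X K pol \<longleftrightarrow>
     (\<forall>x\<in>space X. (\<forall>a\<in>{1..K}. 0 \<le> pol x a) \<and> (\<Sum>a\<in>{1..K}. pol x a) = 1) \<and>
     (\<forall>a\<in>{1..K}. (\<lambda>x. pol x a) \<in> borel_measurable X)"

definition action_dist :: "nat \<Rightarrow> ('x \<Rightarrow> nat \<Rightarrow> real) \<Rightarrow> 'x \<Rightarrow> nat measure" where
  "action_dist K pol x = point_measure {1..K} (\<lambda>a. ennreal (pol x a))"

definition mean_cost :: "('x \<Rightarrow> nat \<Rightarrow> real measure) \<Rightarrow> 'x \<Rightarrow> nat \<Rightarrow> real" where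
  "mean_cost p x a = (\<integral>c. c \<partial>p x a)"

definition risk ::
  "'x measure \<Rightarrow> nat \<Rightarrow> ('x \<Rightarrow> nat \<Rightarrow> real measure) \<Rightarrow> ('x \<Rightarrow> nat \<Rightarrow> real) \<Rightarrow> real" where
  "risk \<nu> K p pol = (\<integral>x. (\<integral>a. mean_cost p x a \<partial>action_dist K pol x) \<partial>\<nu>)"

text \<open>The law of one logged tuple \<open>(x, a, c)\<close>: draw the context, then the action from the
  behavior policy, then the cost.\<close>

definition log_law ::
  "'x measure \<Rightarrow> nat \<Rightarrow> ('x \<Rightarrow> nat \<Rightarrow> real) \<Rightarrow> ('x \<Rightarrow> nat \<Rightarrow> real measure)
     \<Rightarrow> ('x \<times> nat \<times> real) measure" where
  "log_law \<nu> K \<pi>0 p =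
     \<nu> \<bind> (\<lambda>x. action_dist K \<pi>0 x \<bind> (\<lambda>a. p x a \<bind> (\<lambda>c.
       return (\<nu> \<Otimes>\<^sub>M count_space {1..K} \<Otimes>\<^sub>M cost_space) (x, a, c))))"

text \<open>The i.i.d. data set is the coordinate process on the \<open>n\<close>-fold product space.\<close>

definition logged_data ::
  "nat \<Rightarrow> 'x measure \<Rightarrow> nat \<Rightarrow> ('x \<Rightarrow> nat \<Rightarrow> real) \<Rightarrow> ('x \<Rightarrow> nat \<Rightarrow> real measure)
     \<Rightarrow> (nat \<Rightarrow> 'x \<times> nat \<times> real) measure" where
  "logged_data n \<nu> K \<pi>0 p = (\<Pi>\<^sub>M i\<in>{1..n}. log_law \<nu> K \<pi>0 p)"

definition pac_policy :: "('t \<Rightarrow> 'x \<Rightarrow> nat) \<Rightarrow> 't measure \<Rightarrow> 'x \<Rightarrow> nat \<Rightarrow> real" where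
  "pac_policy f Q x a = (\<integral>\<theta>. of_bool (f \<theta> x = a) \<partial>Q)"

definition R_lin ::
  "real \<Rightarrow> nat \<Rightarrow> ('x \<Rightarrow> nat \<Rightarrow> real) \<Rightarrow> (nat \<Rightarrow> 'x \<times> nat \<times> real)
     \<Rightarrow> ('x \<Rightarrow> nat \<Rightarrow> real) \<Rightarrow> real" where
  "R_lin lam n \<pi>0 D pol =
     - (1 / real n) * (\<Sum>i\<in>{1..n}. case D i of (x, a, c) \<Rightarrow>
         pol x a / lam * ln (1 - lam * c / \<pi>0 x a))"

text \<open>Extended to infinite arguments by continuity (for positive \<open>lam\<close>); the bound uses the value
  at \<open>\<infinity>\<close> when the divergence is infinite, and never the value at \<open>-\<infinity>\<close>.\<close>

fun psi :: "real \<Rightarrow> ereal \<Rightarrow> ereal" where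
  "psi lam (ereal x) = ereal (1 / lam * (1 - exp (- lam * x)))"
| "psi lam PInfty = ereal (1 / lam)"
| "psi lam MInfty = -\<infinity>"

text \<open>\<open>KL_divergence\<close> is real-valued, with an arbitrary value when the divergence is infinite. For
  probability measures with \<open>Q\<close> absolutely continuous with respect to \<open>P\<close>, the negative part of
  $\ln (dQ/dP)$ is always \<open>Q\<close>-integrable, so non-integrability means that the divergence is \<open>\<infinity>\<close>.
  Note the argument order of \<open>KL_divergence\<close>: the reference measure comes first.\<close>

definition KL :: "'t measure \<Rightarrow> 't measure \<Rightarrow> ereal" where
  "KL Q P =
     (if absolutely_continuous P Q \<and> integrable Q (entropy_density (exp 1) P Q)
      then ereal (KL_divergence (exp 1) P Q) else \<infinity>)"

end

theory Submission
  imports Defs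
begin

text \<open>For a fixed predictor $f_\theta$ let $\ell_\theta(x, a, c) = 1 - \lambda c\, 1[f_\theta(x) = a] / \pi_0(a|x)$.
  Because the indicator is $0$ or $1$, $\ln \ell_\theta$ is linear in it, so averaging over $\theta \sim Q$ turns
  $\sum_i \ln \ell_\theta(x_i, a_i, c_i)$ into $-\lambda n$ times the estimator of $\pi_Q$. Importance weighting and $c \le 0$
  give $E[\ell_\theta] \le 1 - \lambda R(\theta)$, hence the likelihood ratio
  $\prod_i \ell_\theta(x_i, a_i, c_i) / (1 - \lambda R(\theta))$ has mean at most $1$ under the data. By Markov's
  inequality its $P$-average is at most $1/\delta$ with probability $1 - \delta$; the change of measure from
  $P$ to $Q$ and Jensen's inequality for $\ln$ then give the bound for all $Q$ at once.\<close>

section \<open>The entropy inequality behind the change of measure\<close>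

lemma log_exp_one: "log (exp 1) x = ln x"
  by (simp add: log_def)

text \<open>One half of the Donsker-Varadhan variational formula. With \<open>q\<close> the density
  of \<open>Q\<close> with respect to \<open>P\<close>, the ratio \<open>h / q\<close> has
  \<open>Q\<close>-mean at most \<open>C\<close>; the bound on its logarithm then comes from
  \<open>ln y \<le> y - 1\<close>.\<close>

lemma change_of_measure_inequality:
  fixes h :: "'a \<Rightarrow> real"
  assumes "prob_space P" "prob_space Q"
    and ac: "absolutely_continuous P Q" and sets_eq: "sets Q = sets P"
    and kl: "integrable Q (entropy_density (exp 1) P Q)"
    and h [measurable]: "h \<in> borel_measurable P"
    and h_pos: "\<And>x. x \<in> space P \<Longrightarrow> 0 < h x"
    and ln_h: "integrable Q (\<lambda>x. ln (h x))"
    and "0 < C" and h_le: "(\<integral>\<^sup>+x. h x \<partial>P) \<le> ennreal C"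
  shows "(\<integral>x. ln (h x) \<partial>Q) \<le> KL_divergence (exp 1) P Q + ln C"
proof -
  interpret P: prob_space P by fact
  interpret Q: prob_space Q by fact
  note [measurable_cong] = sets_eq
  \<comment> \<open>\<open>enn2real\<close> sends an infinite derivative to 0; this happens only on
    a \<open>P\<close>-null set, because \<open>Q\<close> is sigma-finite.\<close>
  define q where "q x = enn2real (RN_deriv P Q x)" for x
  have q [measurable]: "q \<in> borel_measurable P"
    unfolding q_def by measurable
  have q0: "0 \<le> q x" for x
    by (simp add: q_def)
  have "AE x in P. ennreal (q x) = RN_deriv P Q x"
    using P.RN_deriv_finite[OF Q.sigma_finite_measure_axioms ac sets_eq]
    by eventually_elim (simp add: q_def ennreal_enn2real_if)
  then have "density P (\<lambda>x. ennreal (q x)) = density P (RN_deriv P Q)"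
    by (intro density_cong) auto
  then have dens: "density P (\<lambda>x. ennreal (q x)) = Q"
    using P.density_RN_deriv[OF ac sets_eq] by simp
  \<comment> \<open>Since \<open>q\<close> is the density of \<open>Q\<close>, its zero set carries
    no \<open>Q\<close>-mass, although it may carry \<open>P\<close>-mass.\<close>
  have q_pos: "AE x in Q. 0 < q x"
    by (subst dens[symmetric], subst AE_density) (auto simp: ennreal_eq_0_iff less_le q0)
  have "(\<integral>\<^sup>+x. ennreal (h x / q x) \<partial>Q) = (\<integral>\<^sup>+x. ennreal (q x) * ennreal (h x / q x) \<partial>P)"
    by (subst dens[symmetric], subst nn_integral_density) auto
  \<comment> \<open>Equality can fail where \<open>q\<close> vanishes: there the left integrand is 0
    while \<open>h\<close> is positive.\<close>
  also have "\<dots> \<le> (\<integral>\<^sup>+x. h x \<partial>P)"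
    using q0 h_pos
    by (intro nn_integral_mono) (auto simp: ennreal_mult'[symmetric] less_imp_le intro!: ennreal_leI)
  finally have ratio: "(\<integral>\<^sup>+x. ennreal (h x / q x) \<partial>Q) \<le> ennreal C"
    using h_le by (rule order_trans)
  have ratio_nonneg: "AE x in Q. 0 \<le> h x / q x"
    using q0 h_pos sets_eq_imp_space_eq[OF sets_eq] by (intro AE_I2) (simp add: less_imp_le)
  have int_ratio: "integrable Q (\<lambda>x. h x / q x)"
    using ratio ratio_nonneg by (intro integrableI_nonneg) (auto intro: le_less_trans)
  have "(\<integral>x. h x / q x \<partial>Q) \<le> C"
    using ratio ratio_nonneg \<open>0 < C\<close> by (simp add: nn_integral_eq_integral[OF int_ratio])
  have ent: "entropy_density (exp 1) P Q = (\<lambda>x. ln (q x))"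
    by (auto simp: entropy_density_def log_exp_one q_def)
  \<comment> \<open>This is \<open>ln y \<le> y - 1\<close> at \<open>y = h x / q x / C\<close>.
    Scaling by \<open>C\<close> makes the \<open>Q\<close>-mean of \<open>y\<close> at most 1, so
    the \<open>- 1\<close> absorbs it and only \<open>ln C\<close> remains.\<close>
  have "(\<integral>x. ln (h x) - ln (q x) \<partial>Q) \<le> (\<integral>x. h x / q x / C - 1 + ln C \<partial>Q)"
  proof (rule integral_mono_AE)
    show "AE x in Q. ln (h x) - ln (q x) \<le> h x / q x / C - 1 + ln C"
      using q_pos AE_space
    proof eventually_elim
      case (elim x)
      then have "0 < h x" "0 < q x"
        using h_pos sets_eq_imp_space_eq[OF sets_eq] by auto
      then show ?case
        using ln_le_minus_one[of "h x / q x / C"] \<open>0 < C\<close> by (simp add: ln_div ln_mult)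
    qed
  qed (use ln_h kl int_ratio in \<open>auto simp: ent simp del: divide_divide_eq_left\<close>)
  also have "\<dots> = (\<integral>x. h x / q x \<partial>Q) / C - 1 + ln C"
    using int_ratio by (simp add: Q.prob_space del: divide_divide_eq_left)
  also have "\<dots> \<le> ln C"
    using \<open>(\<integral>x. h x / q x \<partial>Q) \<le> C\<close> \<open>0 < C\<close> by simp
  finally show ?thesis
    using ln_h kl by (simp add: KL_divergence_def ent)
qed

section \<open>The law of one logged tuple\<close>

locale logged_bandit = prob_space \<nu>
  for \<nu> :: "'x measure" and K :: nat and \<pi>0 :: "'x \<Rightarrow> nat \<Rightarrow> real"
    and p :: "'x \<Rightarrow> nat \<Rightarrow> real measure" +
  assumes policy: "is_policy \<nu> K \<pi>0"
    and cost_kernel [measurable]: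
      "(\<lambda>(x, a). p x a) \<in> \<nu> \<Otimes>\<^sub>M count_space {1..K} \<rightarrow>\<^sub>M prob_algebra cost_space"
begin

abbreviation log_space :: "('x \<times> nat \<times> real) measure" where
  "log_space \<equiv> \<nu> \<Otimes>\<^sub>M count_space {1..K} \<Otimes>\<^sub>M cost_space"

abbreviation log_dist :: "('x \<times> nat \<times> real) measure" where
  "log_dist \<equiv> log_law \<nu> K \<pi>0 p"

lemma behavior_nonneg: "x \<in> space \<nu> \<Longrightarrow> a \<in> {1..K} \<Longrightarrow> 0 \<le> \<pi>0 x a"
  and behavior_sum: "x \<in> space \<nu> \<Longrightarrow> (\<Sum>a\<in>{1..K}. \<pi>0 x a) = 1"
  using policy by (auto simp: is_policy_def)

text \<open>\<open>is_policy\<close> gives measurability in the context for each fixed action. Since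
  the actions are finitely many, the functions for fixed actions glue to a jointly measurable
  one.\<close>

lemma behavior_measurable [measurable]:
  "(\<lambda>(x, a). \<pi>0 x a) \<in> borel_measurable (\<nu> \<Otimes>\<^sub>M count_space {1..K})"
proof -
  have "(\<lambda>z. \<pi>0 (fst z) (snd z)) \<in> borel_measurable (\<nu> \<Otimes>\<^sub>M count_space {1..K})"
  proof (rule measurable_compose_countable'[where g = snd and I = "{1..K}"])
    show "(\<lambda>z. \<pi>0 (fst z) a) \<in> borel_measurable (\<nu> \<Otimes>\<^sub>M count_space {1..K})" if "a \<in> {1..K}" for a
      using policy that by (intro measurable_compose[OF measurable_fst]) (simp add: is_policy_def)
  qed auto
  then show ?thesis by (simp add: split_beta)
qed

lemma cost_dist:
  assumes "x \<in> space \<nu>" "a \<in> {1..K}"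
  shows "prob_space (p x a)" "sets (p x a) = sets cost_space" "space (p x a) = {-1..0}"
proof -
  have "p x a \<in> space (prob_algebra cost_space)"
    using measurable_space[OF cost_kernel, of "(x, a)"] assms by (simp add: space_pair_measure)
  then show "prob_space (p x a)" "sets (p x a) = sets cost_space"
    by (auto simp: space_prob_algebra)
  then show "space (p x a) = {-1..0}"
    using sets_eq_imp_space_eq[of "p x a" cost_space] by (simp add: space_restrict_space)
qed

lemma integrable_cost:
  assumes "x \<in> space \<nu>" "a \<in> {1..K}"
  shows "integrable (p x a) (\<lambda>c. c)"
proof -
  interpret c: prob_space "p x a" by (rule cost_dist) fact+
  have "(\<lambda>c. c) \<in> borel_measurable (p x a)"
    by (subst measurable_cong_sets[OF cost_dist(2)[OF assms] refl]) (simp add: measurable_restrict_space1)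
  then show ?thesis
    using cost_dist(3)[OF assms] by (intro c.integrable_const_bound[of _ 1]) (auto intro!: AE_I2)
qed

lemma mean_cost_bounds:
  assumes "x \<in> space \<nu>" "a \<in> {1..K}"
  shows "-1 \<le> mean_cost p x a" "mean_cost p x a \<le> 0"
proof -
  interpret c: prob_space "p x a" by (rule cost_dist) fact+
  show "-1 \<le> mean_cost p x a" "mean_cost p x a \<le> 0"
    unfolding mean_cost_def using cost_dist(3)[OF assms]
    by (auto intro!: c.integral_ge_const c.integral_le_const AE_I2 integrable_cost assms)
qed

text \<open>Integrating a fixed function is a measurable functional of the measure; it is composed
  here with the cost kernel.\<close>

lemma mean_cost_measurable [measurable]:
  "(\<lambda>(x, a). mean_cost p x a) \<in> borel_measurable (\<nu> \<Otimes>\<^sub>M count_space {1..K})"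
proof -
  have "(\<lambda>M. \<integral>c. c \<partial>M) \<in> borel_measurable (subprob_algebra cost_space)"
    by (intro integral_measurable_subprob_algebra measurable_restrict_space1) simp
  from measurable_compose[OF measurable_prob_algebraD[OF cost_kernel] this]
  show ?thesis by (simp add: mean_cost_def split_beta)
qed

text \<open>A kernel is measurable if the mass of each measurable set is; here that mass is a finite
  sum of measurable functions of the context.\<close>

lemma action_dist_measurable [measurable]:
  "action_dist K \<pi>0 \<in> \<nu> \<rightarrow>\<^sub>M prob_algebra (count_space {1..K})"
proof (rule measurable_prob_algebraI)
  show prob: "prob_space (action_dist K \<pi>0 x)" if "x \<in> space \<nu>" for x
    using behavior_sum[OF that] behavior_nonneg[OF that]
    by (intro prob_spaceI)
      (simp add: action_dist_def emeasure_point_measure_finite space_point_measure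
        del: atLeastAtMost_iff One_nat_def)
  show "action_dist K \<pi>0 \<in> \<nu> \<rightarrow>\<^sub>M subprob_algebra (count_space {1..K})"
  proof (rule measurable_subprob_algebra)
    fix A assume "A \<in> sets (count_space {1..K})"
    then have A: "A \<subseteq> {1..K}" by simp
    have "(\<lambda>x. \<Sum>a\<in>A. ennreal (\<pi>0 x a)) \<in> borel_measurable \<nu>"
      using A policy by (intro borel_measurable_sum) (auto simp: is_policy_def subset_iff)
    then show "(\<lambda>x. emeasure (action_dist K \<pi>0 x) A) \<in> borel_measurable \<nu>"
      using A by (simp add: action_dist_def emeasure_point_measure_finite)
  qed (use prob prob_space_imp_subprob_space in
      \<open>auto simp: action_dist_def sets_point_measure simp del: One_nat_def\<close>)
qed

text \<open>\<open>log_law\<close> is a nested bind, so its inner kernels must be measurable in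
  everything drawn before them: here in context and action, in the next lemma in the context
  alone.\<close>

lemma cost_step_measurable [measurable]:
  "(\<lambda>(x, a). p x a \<bind> (\<lambda>c. return log_space (x, a, c)))
     \<in> \<nu> \<Otimes>\<^sub>M count_space {1..K} \<rightarrow>\<^sub>M prob_algebra log_space"
  by measurable

lemma action_step_measurable [measurable]:
  "(\<lambda>x. action_dist K \<pi>0 x \<bind> (\<lambda>a. p x a \<bind> (\<lambda>c. return log_space (x, a, c))))
     \<in> \<nu> \<rightarrow>\<^sub>M prob_algebra log_space"
  by measurable

lemma log_dist_prob: "prob_space log_dist"
  and sets_log_dist [measurable_cong]: "sets log_dist = sets log_space"
proof -
  have "\<nu> \<in> space (prob_algebra \<nu>)"
    by (simp add: space_prob_algebra prob_space_axioms)
  from prob_space_bind'[OF this action_step_measurable] sets_bind'[OF this action_step_measurable]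
  show "prob_space log_dist" "sets log_dist = sets log_space"
    unfolding log_law_def by auto
qed

text \<open>Each bind becomes an iterated integral, the action integral is a finite weighted sum,
  and the final \<open>return\<close> evaluates \<open>g\<close> at the tuple.\<close>

lemma nn_integral_log_dist:
  assumes g [measurable]: "g \<in> borel_measurable log_space"
  shows "(\<integral>\<^sup>+z. g z \<partial>log_dist)
    = (\<integral>\<^sup>+x. (\<Sum>a\<in>{1..K}. ennreal (\<pi>0 x a) * (\<integral>\<^sup>+c. g (x, a, c) \<partial>p x a)) \<partial>\<nu>)"
proof -
  have "(\<integral>\<^sup>+z. g z \<partial>log_dist) = (\<integral>\<^sup>+x. \<integral>\<^sup>+z. g z
      \<partial>(action_dist K \<pi>0 x \<bind> (\<lambda>a. p x a \<bind> (\<lambda>c. return log_space (x, a, c)))) \<partial>\<nu>)"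
    unfolding log_law_def
    by (intro nn_integral_bind[OF g] measurable_prob_algebraD action_step_measurable)
  also have "\<dots> = (\<integral>\<^sup>+x. \<integral>\<^sup>+a. \<integral>\<^sup>+z. g z
      \<partial>(p x a \<bind> (\<lambda>c. return log_space (x, a, c))) \<partial>action_dist K \<pi>0 x \<partial>\<nu>)"
  proof (intro nn_integral_cong nn_integral_bind[OF g])
    fix x assume x: "x \<in> space \<nu>"
    have "(\<lambda>a. p x a \<bind> (\<lambda>c. return log_space (x, a, c)))
        \<in> count_space {1..K} \<rightarrow>\<^sub>M subprob_algebra log_space"
      using measurable_prob_algebraD[OF measurable_compose[OF measurable_Pair1'[OF x] cost_step_measurable]]
      by simp
    then show "(\<lambda>a. p x a \<bind> (\<lambda>c. return log_space (x, a, c)))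
        \<in> action_dist K \<pi>0 x \<rightarrow>\<^sub>M subprob_algebra log_space"
      by (simp add: action_dist_def)
  qed
  also have "\<dots> = (\<integral>\<^sup>+x. (\<Sum>a\<in>{1..K}. ennreal (\<pi>0 x a) * (\<integral>\<^sup>+c. g (x, a, c) \<partial>p x a)) \<partial>\<nu>)"
  proof (rule nn_integral_cong)
    fix x assume x: "x \<in> space \<nu>"
    have "(\<integral>\<^sup>+z. g z \<partial>(p x a \<bind> (\<lambda>c. return log_space (x, a, c)))) = (\<integral>\<^sup>+c. g (x, a, c) \<partial>p x a)"
      if a: "a \<in> {1..K}" for a
    proof -
      have "a \<in> space (count_space {1..K})"
        using a by simp
      then have "(\<lambda>c. return log_space (x, a, c)) \<in> cost_space \<rightarrow>\<^sub>M subprob_algebra log_space"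
        using x by measurable
      then have "(\<lambda>c. return log_space (x, a, c)) \<in> p x a \<rightarrow>\<^sub>M subprob_algebra log_space"
        by (simp only: measurable_cong_sets[OF cost_dist(2)[OF x a] refl])
      then have "(\<integral>\<^sup>+z. g z \<partial>(p x a \<bind> (\<lambda>c. return log_space (x, a, c))))
          = (\<integral>\<^sup>+c. \<integral>\<^sup>+z. g z \<partial>return log_space (x, a, c) \<partial>p x a)"
        by (rule nn_integral_bind[OF g])
      also have "\<dots> = (\<integral>\<^sup>+c. g (x, a, c) \<partial>p x a)"
        using x a cost_dist(3)[OF x a]
        by (intro nn_integral_cong nn_integral_return g)
          (auto simp: space_pair_measure space_restrict_space)
      finally show ?thesis .
    qed
    then show "(\<integral>\<^sup>+a. \<integral>\<^sup>+z. g z \<partial>(p x a \<bind> (\<lambda>c. return log_space (x, a, c)))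
        \<partial>action_dist K \<pi>0 x) = (\<Sum>a\<in>{1..K}. ennreal (\<pi>0 x a) * (\<integral>\<^sup>+c. g (x, a, c) \<partial>p x a))"
      by (simp add: action_dist_def nn_integral_point_measure_finite)
  qed
  finally show ?thesis .
qed

section \<open>Risk and weighted loss of a single predictor\<close>

definition predictor_risk :: "('x \<Rightarrow> nat) \<Rightarrow> real" where
  "predictor_risk g = (\<integral>x. mean_cost p x (g x) \<partial>\<nu>)"

text \<open>A tuple whose action has \<open>\<pi>0 x a = 0\<close> gets the value 1, by the
  convention that division by 0 yields 0; such tuples occur with probability 0.\<close>

definition loss_weight :: "real \<Rightarrow> ('x \<Rightarrow> nat) \<Rightarrow> 'x \<times> nat \<times> real \<Rightarrow> real" where
  "loss_weight lam g = (\<lambda>(x, a, c). 1 - lam * (of_bool (g x = a) * c) / \<pi>0 x a)"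

lemma integrable_predictor_cost:
  assumes [measurable]: "g \<in> \<nu> \<rightarrow>\<^sub>M count_space {1..K}"
  shows "integrable \<nu> (\<lambda>x. mean_cost p x (g x))"
  using mean_cost_bounds measurable_space[OF assms]
  by (intro integrable_const_bound[of _ 1]) (fastforce intro!: AE_I2 simp: abs_le_iff)+

lemma predictor_risk_nonpos:
  assumes "g \<in> \<nu> \<rightarrow>\<^sub>M count_space {1..K}"
  shows "predictor_risk g \<le> 0"
  unfolding predictor_risk_def
  using mean_cost_bounds measurable_space[OF assms]
  by (intro integral_le_const integrable_predictor_cost assms AE_I2) auto

lemma predictor_risk_ge:
  assumes "g \<in> \<nu> \<rightarrow>\<^sub>M count_space {1..K}"
  shows "-1 \<le> predictor_risk g"
  unfolding predictor_risk_def
  using mean_cost_bounds measurable_space[OF assms]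
  by (intro integral_ge_const integrable_predictor_cost assms AE_I2) auto

text \<open>The probability \<open>\<pi>0 x a\<close> of drawing the action cancels the importance
  weight, and summing over actions leaves the cost at \<open>g x\<close> only. An upper bound is
  enough, because the likelihood ratio divides by the right-hand side.\<close>

lemma nn_integral_loss_weight_le:
  assumes g [measurable]: "g \<in> \<nu> \<rightarrow>\<^sub>M count_space {1..K}" and "0 < lam"
    and [measurable]: "loss_weight lam g \<in> borel_measurable log_space"
  shows "(\<integral>\<^sup>+z. ennreal (loss_weight lam g z) \<partial>log_dist) \<le> ennreal (1 - lam * predictor_risk g)"
proof -
  have action: "ennreal (\<pi>0 x a) * (\<integral>\<^sup>+c. ennreal (loss_weight lam g (x, a, c)) \<partial>p x a)
      \<le> ennreal (\<pi>0 x a - lam * (of_bool (g x = a) * mean_cost p x a))"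
    \<comment> \<open>strict when the predictor picks an action of negative mean cost that the behavior policy never plays\<close>
    if x: "x \<in> space \<nu>" and a: "a \<in> {1..K}" for x a
  proof (cases "\<pi>0 x a = 0")
    case False
    interpret c: prob_space "p x a" by (rule cost_dist) fact+
    have pos: "0 < \<pi>0 x a"
      using False behavior_nonneg[OF x a] by simp
    have int: "integrable (p x a) (\<lambda>c. loss_weight lam g (x, a, c))"
      unfolding loss_weight_def using integrable_cost[OF x a] by simp
    have "0 \<le> loss_weight lam g (x, a, c)" if "c \<in> space (p x a)" for c
    proof -
      have "lam * (of_bool (g x = a) * c) / \<pi>0 x a \<le> 0"
        using that pos \<open>0 < lam\<close> cost_dist(3)[OF x a]
        by (intro divide_nonpos_pos mult_nonneg_nonpos) auto
      then show ?thesis by (simp add: loss_weight_def)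
    qed
    then have "(\<integral>\<^sup>+c. ennreal (loss_weight lam g (x, a, c)) \<partial>p x a)
        = ennreal (\<integral>c. loss_weight lam g (x, a, c) \<partial>p x a)"
      by (intro nn_integral_eq_integral int AE_I2)
    also have "(\<integral>c. loss_weight lam g (x, a, c) \<partial>p x a)
        = 1 - lam * (of_bool (g x = a) * mean_cost p x a) / \<pi>0 x a"
      unfolding loss_weight_def mean_cost_def using integrable_cost[OF x a] by (simp add: c.prob_space)
    finally show ?thesis
      using pos by (simp add: ennreal_mult'[symmetric] right_diff_distrib)
  qed simp
  have "(\<integral>\<^sup>+z. ennreal (loss_weight lam g z) \<partial>log_dist)
      \<le> (\<integral>\<^sup>+x. ennreal (1 - lam * mean_cost p x (g x)) \<partial>\<nu>)"
  proof (subst nn_integral_log_dist, measurable, intro nn_integral_mono)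
    fix x assume x: "x \<in> space \<nu>"
    then have gx: "g x \<in> {1..K}"
      using measurable_space[OF g] by simp
    \<comment> \<open>Nonnegative terms are required to move the sum inside \<open>ennreal\<close>,
      which truncates negative reals to 0.\<close>
    have "0 \<le> \<pi>0 x a - lam * (of_bool (g x = a) * mean_cost p x a)" if "a \<in> {1..K}" for a
      using mean_cost_bounds(2)[OF x that] behavior_nonneg[OF x that] \<open>0 < lam\<close>
      by (simp add: mult_le_0_iff order_trans[of _ 0])
    then have "(\<Sum>a\<in>{1..K}. ennreal (\<pi>0 x a - lam * (of_bool (g x = a) * mean_cost p x a)))
        = ennreal (\<Sum>a\<in>{1..K}. \<pi>0 x a - lam * (of_bool (g x = a) * mean_cost p x a))"
      by (rule sum_ennreal)
    \<comment> \<open>Exactly one action survives the indicator, because \<open>g x\<close> lies in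
      \<open>{1..K}\<close>.\<close>
    also have "(\<Sum>a\<in>{1..K}. of_bool (g x = a) * mean_cost p x a) = mean_cost p x (g x)"
      using gx by (simp add: of_bool_def if_distrib[of "\<lambda>y. y * _"] cong: if_cong)
    then have "(\<Sum>a\<in>{1..K}. \<pi>0 x a - lam * (of_bool (g x = a) * mean_cost p x a))
        = 1 - lam * mean_cost p x (g x)"
      using behavior_sum[OF x] by (simp add: sum_subtractf sum_distrib_left[symmetric])
    finally show "(\<Sum>a\<in>{1..K}. ennreal (\<pi>0 x a)
        * (\<integral>\<^sup>+c. ennreal (loss_weight lam g (x, a, c)) \<partial>p x a))
        \<le> ennreal (1 - lam * mean_cost p x (g x))"
      using sum_mono[OF action[OF x], of "{1..K}" "\<lambda>a. a"] by simp
  qed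
  also have "\<dots> = ennreal (\<integral>x. 1 - lam * mean_cost p x (g x) \<partial>\<nu>)"
  proof (intro nn_integral_eq_integral AE_I2)
    fix x assume "x \<in> space \<nu>"
    then have "lam * mean_cost p x (g x) \<le> 0"
      using mean_cost_bounds(2) measurable_space[OF g] \<open>0 < lam\<close>
      by (intro mult_nonneg_nonpos) auto
    then show "0 \<le> 1 - lam * mean_cost p x (g x)"
      by simp
  qed (use integrable_predictor_cost[OF g] in simp)
  also have "(\<integral>x. 1 - lam * mean_cost p x (g x) \<partial>\<nu>) = 1 - lam * predictor_risk g"
    using integrable_predictor_cost[OF g] by (simp add: predictor_risk_def prob_space)
  finally show ?thesis .
qed

end

section \<open>Policies induced by distributions on predictors\<close>

locale pac_bayes_bandit = logged_bandit \<nu> K \<pi>0 p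
  for \<nu> :: "'x measure" and K and \<pi>0 and p +
  fixes T :: "'t measure" and f :: "'t \<Rightarrow> 'x \<Rightarrow> nat" and lam :: real
  assumes predictor [measurable]:
      "(\<lambda>(\<theta>, x). f \<theta> x) \<in> T \<Otimes>\<^sub>M \<nu> \<rightarrow>\<^sub>M count_space {1..K}"
    and lam_pos: "0 < lam"
begin

lemma predictor_section: "\<theta> \<in> space T \<Longrightarrow> f \<theta> \<in> \<nu> \<rightarrow>\<^sub>M count_space {1..K}"
  using measurable_compose[OF measurable_Pair1' predictor] by simp

lemma predicts_measurable:
  assumes "x \<in> space \<nu>"
  shows "Measurable.pred T (\<lambda>\<theta>. f \<theta> x = a)"
proof -
  have "(\<lambda>\<theta>. f \<theta> x) \<in> T \<rightarrow>\<^sub>M count_space {1..K}"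
    using measurable_compose[OF measurable_Pair2' predictor] assms by simp
  then show ?thesis
    by (rule pred_eq_const1) simp
qed

lemma loss_weight_measurable [measurable]:
  "(\<lambda>(\<theta>, z). loss_weight lam (f \<theta>) z) \<in> borel_measurable (T \<Otimes>\<^sub>M log_space)"
proof -
  have "(\<lambda>c. c) \<in> borel_measurable cost_space"
    by (intro measurable_restrict_space1) simp
  note [measurable] = measurable_compose[OF _ this]
  \<comment> \<open>The event compares two random actions. It is split according to the finitely
    many values of the logged action, which leaves comparisons with a constant.\<close>
  have "Measurable.pred (T \<Otimes>\<^sub>M log_space) (\<lambda>y. f (fst y) (fst (snd y)) = fst (snd (snd y)))"
  proof (rule measurable_compose_countable'[where g = "\<lambda>y. fst (snd (snd y))" and I = "{1..K}"])
    fix a assume "a \<in> {1..K}"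
    then show "Measurable.pred (T \<Otimes>\<^sub>M log_space) (\<lambda>y. f (fst y) (fst (snd y)) = a)"
      by (intro pred_eq_const1[where N = "count_space {1..K}"]) measurable
  qed auto
  then show ?thesis
    unfolding loss_weight_def split_beta by measurable
qed

lemma predictor_risk_measurable [measurable]: "(\<lambda>\<theta>. predictor_risk (f \<theta>)) \<in> borel_measurable T"
  unfolding predictor_risk_def by measurable

text \<open>The risk is linear in the policy, and \<open>pac_policy f Q\<close> is a
  \<open>Q\<close>-mixture of deterministic policies. The mixture moves out of the finite sum over
  actions and then, by Fubini, out of the integral over contexts.\<close>

lemma risk_pac_policy:
  assumes Q: "Q \<in> space (prob_algebra T)"
  shows "integrable Q (\<lambda>\<theta>. predictor_risk (f \<theta>))"
    and "risk \<nu> K p (pac_policy f Q) = (\<integral>\<theta>. predictor_risk (f \<theta>) \<partial>Q)"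
proof -
  interpret Q: prob_space Q
    using Q by (simp add: space_prob_algebra)
  have [measurable_cong]: "sets Q = sets T"
    using Q by (simp add: space_prob_algebra)
  then have space_Q: "space Q = space T"
    by (rule sets_eq_imp_space_eq)
  interpret \<nu>Q: pair_prob_space \<nu> Q ..
  have range: "f \<theta> x \<in> {1..K}" if "\<theta> \<in> space Q" "x \<in> space \<nu>" for \<theta> x
    using measurable_space[OF predictor_section[of \<theta>] that(2)] that(1) by (simp add: space_Q)
  show "integrable Q (\<lambda>\<theta>. predictor_risk (f \<theta>))"
    using predictor_risk_ge predictor_risk_nonpos predictor_section
    by (intro Q.integrable_const_bound[of _ 1]) (fastforce intro!: AE_I2 simp: space_Q abs_le_iff)+
  have policy_value: "(\<integral>a. mean_cost p x a \<partial>action_dist K (pac_policy f Q) x)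
      = (\<integral>\<theta>. mean_cost p x (f \<theta> x) \<partial>Q)" if x: "x \<in> space \<nu>" for x
  proof -
    have [measurable]: "Measurable.pred Q (\<lambda>\<theta>. f \<theta> x = a)" for a
      using predicts_measurable[OF x] by measurable
    have int: "integrable Q (\<lambda>\<theta>. of_bool (f \<theta> x = a) :: real)" for a
      by (intro Q.integrable_const_bound[of _ 1]) auto
    have "(\<integral>a. mean_cost p x a \<partial>action_dist K (pac_policy f Q) x)
        = (\<Sum>a\<in>{1..K}. (\<integral>\<theta>. of_bool (f \<theta> x = a) \<partial>Q) * mean_cost p x a)"
      unfolding action_dist_def
      by (subst lebesgue_integral_point_measure_finite) (auto simp: pac_policy_def)
    also have "\<dots> = (\<integral>\<theta>. (\<Sum>a\<in>{1..K}. of_bool (f \<theta> x = a) * mean_cost p x a) \<partial>Q)"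
      using int by (subst Bochner_Integration.integral_sum) simp_all
    also have "\<dots> = (\<integral>\<theta>. mean_cost p x (f \<theta> x) \<partial>Q)"
      using range[OF _ x]
      by (intro Bochner_Integration.integral_cong refl)
        (simp add: of_bool_def if_distrib[of "\<lambda>y. y * _"] cong: if_cong)
    finally show ?thesis .
  qed
  \<comment> \<open>Fubini applies because mean costs lie in \<open>[-1, 0]\<close>.\<close>
  have "integrable (\<nu> \<Otimes>\<^sub>M Q) (\<lambda>(x, \<theta>). mean_cost p x (f \<theta> x))"
    using mean_cost_bounds range
    by (intro \<nu>Q.P.integrable_const_bound[of _ 1])
      (fastforce intro!: AE_I2 simp: space_pair_measure abs_le_iff, measurable)
  from \<nu>Q.Fubini_integral[OF this]
  have "(\<integral>x. \<integral>\<theta>. mean_cost p x (f \<theta> x) \<partial>Q \<partial>\<nu>) = (\<integral>\<theta>. predictor_risk (f \<theta>) \<partial>Q)"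
    by (simp add: predictor_risk_def)
  moreover have "risk \<nu> K p (pac_policy f Q) = (\<integral>x. \<integral>\<theta>. mean_cost p x (f \<theta> x) \<partial>Q \<partial>\<nu>)"
    unfolding risk_def using policy_value by (intro Bochner_Integration.integral_cong) auto
  ultimately show "risk \<nu> K p (pac_policy f Q) = (\<integral>\<theta>. predictor_risk (f \<theta>) \<partial>Q)"
    by simp
qed

section \<open>The likelihood ratio of a predictor and its mean\<close>

definition likelihood :: "nat \<Rightarrow> (nat \<Rightarrow> 'x \<times> nat \<times> real) \<Rightarrow> 't \<Rightarrow> real" where
  "likelihood n D \<theta> = (\<Prod>i\<in>{1..n}. loss_weight lam (f \<theta>) (D i) / (1 - lam * predictor_risk (f \<theta>)))"

lemma sets_logged_data [measurable_cong]:
  "sets (logged_data n \<nu> K \<pi>0 p) = sets (\<Pi>\<^sub>M i\<in>{1..n}. log_space)"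
  unfolding logged_data_def by (intro sets_PiM_cong refl sets_log_dist)

lemma likelihood_measurable [measurable]:
  "(\<lambda>(D, \<theta>). likelihood n D \<theta>) \<in> borel_measurable (logged_data n \<nu> K \<pi>0 p \<Otimes>\<^sub>M T)"
proof -
  have "(\<lambda>(D, \<theta>). loss_weight lam (f \<theta>) (D i) / (1 - lam * predictor_risk (f \<theta>)))
      \<in> borel_measurable (logged_data n \<nu> K \<pi>0 p \<Otimes>\<^sub>M T)" if "i \<in> {1..n}" for i
    using that by measurable
  then show ?thesis
    unfolding likelihood_def split_beta by (intro borel_measurable_prod)
qed

text \<open>Costs are nonpositive, so a nonpositive quantity is subtracted from 1. This keeps the
  factors of \<open>likelihood\<close> positive and their logarithms meaningful.\<close>

lemma loss_weight_ge_one: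
  assumes "z \<in> space log_space"
  shows "1 \<le> loss_weight lam g z"
proof -
  obtain x a c where z: "z = (x, a, c)" by (cases z)
  with assms have "x \<in> space \<nu>" "a \<in> {1..K}" "c \<le> 0"
    by (auto simp: space_pair_measure space_restrict_space)
  then have "lam * (of_bool (g x = a) * c) / \<pi>0 x a \<le> 0"
    using lam_pos behavior_nonneg by (intro divide_nonpos_nonneg mult_nonneg_nonpos) auto
  then show ?thesis by (simp add: z loss_weight_def)
qed

lemma risk_factor_ge_one: "\<theta> \<in> space T \<Longrightarrow> 1 \<le> 1 - lam * predictor_risk (f \<theta>)"
  using predictor_risk_nonpos predictor_section lam_pos by (simp add: mult_le_0_iff)

text \<open>With the lower bound 1 it bounds the logarithm of this factor, which is therefore
  integrable under every \<open>Q\<close>.\<close>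

lemma risk_factor_le: "\<theta> \<in> space T \<Longrightarrow> 1 - lam * predictor_risk (f \<theta>) \<le> 1 + lam"
  using mult_left_mono[of "-1" "predictor_risk (f \<theta>)" lam] predictor_risk_ge predictor_section lam_pos
  by simp

lemma log_sample:
  "D \<in> space (logged_data n \<nu> K \<pi>0 p) \<Longrightarrow> i \<in> {1..n} \<Longrightarrow> D i \<in> space log_space"
  using sets_eq_imp_space_eq[OF sets_logged_data[of n]] by (auto simp: space_PiM)

lemma logged_data_prob: "prob_space (logged_data n \<nu> K \<pi>0 p)"
  unfolding logged_data_def by (intro prob_space_PiM log_dist_prob)

text \<open>For a fixed \<open>\<theta>\<close> the likelihood ratio is an e-variable. The tuples
  are independent, so the mean of the product is the product of the means, each at most 1 by
  \<open>nn_integral_loss_weight_le\<close>.\<close>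

lemma nn_integral_likelihood_le:
  assumes \<theta>: "\<theta> \<in> space T"
  shows "(\<integral>\<^sup>+D. ennreal (likelihood n D \<theta>) \<partial>logged_data n \<nu> K \<pi>0 p) \<le> 1"
proof -
  interpret L: prob_space log_dist by (rule log_dist_prob)
  interpret prod: product_sigma_finite "\<lambda>_::nat. log_dist" ..
  let ?r = "1 - lam * predictor_risk (f \<theta>)"
  have r: "0 < ?r"
    using risk_factor_ge_one[OF \<theta>] by simp
  have weight [measurable]: "loss_weight lam (f \<theta>) \<in> borel_measurable log_space"
    using measurable_compose[OF measurable_Pair1' loss_weight_measurable] \<theta> by simp
  have "(\<integral>\<^sup>+D. ennreal (likelihood n D \<theta>) \<partial>logged_data n \<nu> K \<pi>0 p)
      = (\<integral>\<^sup>+D. (\<Prod>i\<in>{1..n}. ennreal (loss_weight lam (f \<theta>) (D i) / ?r)) \<partial>logged_data n \<nu> K \<pi>0 p)"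
    using r loss_weight_ge_one[OF log_sample]
    by (intro nn_integral_cong)
      (auto simp: likelihood_def intro!: prod_ennreal[symmetric] divide_nonneg_pos
        intro: order_trans[OF zero_le_one])
  also have "\<dots> = (\<Prod>i\<in>{1..n}. \<integral>\<^sup>+z. ennreal (loss_weight lam (f \<theta>) z / ?r) \<partial>log_dist)"
    unfolding logged_data_def by (intro prod.product_nn_integral_prod) auto
  also have "\<dots> \<le> 1"
  proof -
    have "(\<integral>\<^sup>+z. ennreal (loss_weight lam (f \<theta>) z / ?r) \<partial>log_dist)
        = (\<integral>\<^sup>+z. ennreal (loss_weight lam (f \<theta>) z) * ennreal (1 / ?r) \<partial>log_dist)"
      using r by (intro nn_integral_cong) (simp add: ennreal_mult''[symmetric])
    also have "\<dots> = (\<integral>\<^sup>+z. ennreal (loss_weight lam (f \<theta>) z) \<partial>log_dist) * ennreal (1 / ?r)"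
      by (intro nn_integral_multc) auto
    also have "\<dots> \<le> ennreal ?r * ennreal (1 / ?r)"
      by (intro mult_right_mono nn_integral_loss_weight_le predictor_section \<theta> lam_pos weight) simp
    also have "\<dots> = 1"
      using r by (simp add: ennreal_mult''[symmetric])
    finally show ?thesis
      by (simp add: prod_le_1 power_le_one)
  qed
  finally show ?thesis .
qed

section \<open>The high-probability event\<close>

definition likelihood_event :: "nat \<Rightarrow> 't measure \<Rightarrow> real \<Rightarrow> (nat \<Rightarrow> 'x \<times> nat \<times> real) set" where
  "likelihood_event n P \<delta> = {D \<in> space (logged_data n \<nu> K \<pi>0 p).
    (\<integral>\<^sup>+\<theta>. ennreal (likelihood n D \<theta>) \<partial>P) \<le> ennreal (1 / \<delta>)}"

text \<open>Tonelli moves the mean bound for each fixed \<open>\<theta>\<close> to the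
  \<open>P\<close>-average, and Markov's inequality gives the tail. The event depends on
  \<open>P\<close> but on no \<open>Q\<close>, which makes the later bound uniform over
  posteriors.\<close>

lemma likelihood_event_prob:
  assumes P: "P \<in> space (prob_algebra T)" and "0 < \<delta>"
  shows "likelihood_event n P \<delta> \<in> sets (logged_data n \<nu> K \<pi>0 p)"
    and "1 - \<delta> \<le> measure (logged_data n \<nu> K \<pi>0 p) (likelihood_event n P \<delta>)"
proof -
  let ?E = "likelihood_event n P \<delta>"
  let ?L = "logged_data n \<nu> K \<pi>0 p"
  let ?Z = "\<lambda>D. \<integral>\<^sup>+\<theta>. ennreal (likelihood n D \<theta>) \<partial>P"
  interpret P: prob_space P
    using P by (simp add: space_prob_algebra)
  have [measurable_cong]: "sets P = sets T"
    using P by (simp add: space_prob_algebra)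
  then have space_P: "space P = space T"
    by (rule sets_eq_imp_space_eq)
  interpret L: prob_space ?L by (rule logged_data_prob)
  interpret LP: pair_prob_space ?L P ..
  have [measurable]: "?Z \<in> borel_measurable ?L"
    by measurable
  show E: "?E \<in> sets ?L"
    unfolding likelihood_event_def by measurable
  have "(\<integral>\<^sup>+D. ?Z D \<partial>?L) = (\<integral>\<^sup>+\<theta>. \<integral>\<^sup>+D. ennreal (likelihood n D \<theta>) \<partial>?L \<partial>P)"
    by (rule LP.Fubini'[symmetric]) measurable
  also have "\<dots> \<le> (\<integral>\<^sup>+\<theta>. 1 \<partial>P)"
    using nn_integral_likelihood_le by (intro nn_integral_mono) (simp add: space_P)
  finally have Z: "(\<integral>\<^sup>+D. ?Z D \<partial>?L) \<le> 1"
    by (simp add: P.emeasure_space_1)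
  \<comment> \<open>Off the event \<open>?Z D\<close> exceeds \<open>1 / \<delta>\<close>;
    multiplying by \<open>\<delta>\<close> brings this to the form
    \<open>1 \<le> \<delta> * ?Z D\<close> that Markov's inequality expects.\<close>
  have "emeasure ?L (space ?L - ?E) \<le> emeasure ?L {D \<in> space ?L. 1 \<le> ennreal \<delta> * ?Z D}"
  proof (intro emeasure_mono subsetI)
    fix D assume D: "D \<in> space ?L - ?E"
    then have "ennreal (1 / \<delta>) \<le> ?Z D"
      by (auto simp: likelihood_event_def)
    then have "ennreal \<delta> * ennreal (1 / \<delta>) \<le> ennreal \<delta> * ?Z D"
      by (rule mult_left_mono) simp
    then show "D \<in> {D \<in> space ?L. 1 \<le> ennreal \<delta> * ?Z D}"
      using D \<open>0 < \<delta>\<close> by (simp add: ennreal_mult''[symmetric])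
  qed measurable
  also have "\<dots> \<le> ennreal \<delta> * (\<integral>\<^sup>+D. ?Z D * indicator (space ?L) D \<partial>?L)"
    by (rule nn_integral_Markov_inequality) auto
  also have "\<dots> = ennreal \<delta> * (\<integral>\<^sup>+D. ?Z D \<partial>?L)"
    by (intro arg_cong[where f = "(*) (ennreal \<delta>)"] nn_integral_cong) simp
  also have "\<dots> \<le> ennreal \<delta> * 1"
    by (intro mult_left_mono Z) simp
  finally have "measure ?L (space ?L - ?E) \<le> \<delta>"
    using \<open>0 < \<delta>\<close> by (simp add: L.emeasure_eq_measure)
  then show "1 - \<delta> \<le> measure ?L ?E"
    using L.prob_compl[OF E] by simp
qed

section \<open>Posterior averages of the log-likelihood\<close>

lemma integral_ln_loss_weight:
  assumes Q: "Q \<in> space (prob_algebra T)" and x: "x \<in> space \<nu>"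
  shows "integrable Q (\<lambda>\<theta>. ln (loss_weight lam (f \<theta>) (x, a, c)))"
    and "(\<integral>\<theta>. ln (loss_weight lam (f \<theta>) (x, a, c)) \<partial>Q) = pac_policy f Q x a * ln (1 - lam * c / \<pi>0 x a)"
proof -
  interpret Q: prob_space Q
    using Q by (simp add: space_prob_algebra)
  have [measurable_cong]: "sets Q = sets T"
    using Q by (simp add: space_prob_algebra)
  have [measurable]: "Measurable.pred Q (\<lambda>\<theta>. f \<theta> x = a)"
    using predicts_measurable[OF x] by measurable
  \<comment> \<open>The two values of the indicator are checked separately; where the predictor
    disagrees with \<open>a\<close>, both sides are 0 since \<open>ln 1 = 0\<close>.\<close>
  have eq: "ln (loss_weight lam (f \<theta>) (x, a, c)) = of_bool (f \<theta> x = a) * ln (1 - lam * c / \<pi>0 x a)"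
    for \<theta> by (simp add: loss_weight_def)
  have "integrable Q (\<lambda>\<theta>. of_bool (f \<theta> x = a) :: real)"
    by (intro Q.integrable_const_bound[of _ 1]) auto
  then show "integrable Q (\<lambda>\<theta>. ln (loss_weight lam (f \<theta>) (x, a, c)))"
    and "(\<integral>\<theta>. ln (loss_weight lam (f \<theta>) (x, a, c)) \<partial>Q) = pac_policy f Q x a * ln (1 - lam * c / \<pi>0 x a)"
    by (simp_all add: eq pac_policy_def)
qed

text \<open>Jensen's inequality for the concave \<open>ln\<close>, with the mean identified by
  \<open>risk_pac_policy\<close>. The direction fits because this term enters the log-likelihood
  with a minus sign, where a lower bound is wanted.\<close>

lemma integral_ln_risk_factor:
  assumes Q: "Q \<in> space (prob_algebra T)"
  shows "integrable Q (\<lambda>\<theta>. ln (1 - lam * predictor_risk (f \<theta>)))"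
    and "0 < 1 - lam * risk \<nu> K p (pac_policy f Q)"
    and "(\<integral>\<theta>. ln (1 - lam * predictor_risk (f \<theta>)) \<partial>Q) \<le> ln (1 - lam * risk \<nu> K p (pac_policy f Q))"
proof -
  interpret Q: prob_space Q
    using Q by (simp add: space_prob_algebra)
  have [measurable_cong]: "sets Q = sets T"
    using Q by (simp add: space_prob_algebra)
  then have space_Q: "space Q = space T"
    by (rule sets_eq_imp_space_eq)
  let ?g = "\<lambda>\<theta>. 1 - lam * predictor_risk (f \<theta>)"
  have int: "integrable Q ?g" and mean: "(\<integral>\<theta>. ?g \<theta> \<partial>Q) = 1 - lam * risk \<nu> K p (pac_policy f Q)"
    using risk_pac_policy[OF Q] by (simp_all add: Q.prob_space)
  have "1 \<le> (\<integral>\<theta>. ?g \<theta> \<partial>Q)"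
    using risk_factor_ge_one by (intro Q.integral_ge_const int AE_I2) (simp add: space_Q)
  then show "0 < 1 - lam * risk \<nu> K p (pac_policy f Q)"
    by (simp add: mean)
  \<comment> \<open>The bounds \<open>1 \<le> ?g \<theta> \<le> 1 + lam\<close> come from risks in
    \<open>[-1, 0]\<close>.\<close>
  have "\<bar>ln (?g \<theta>)\<bar> \<le> ln (1 + lam)" if "\<theta> \<in> space Q" for \<theta>
  proof -
    have "1 \<le> ?g \<theta>" "?g \<theta> \<le> 1 + lam"
      using risk_factor_ge_one risk_factor_le that by (auto simp only: space_Q)
    then have "0 \<le> ln (?g \<theta>)" "ln (?g \<theta>) \<le> ln (1 + lam)"
      by (intro ln_ge_zero ln_mono; linarith)+
    then show ?thesis
      by simp
  qed
  then show ln_int: "integrable Q (\<lambda>\<theta>. ln (?g \<theta>))"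
    by (intro Q.integrable_const_bound[of _ "ln (1 + lam)"] AE_I2) auto
  have "convex_on {0<..} (\<lambda>x. - ln x :: real)"
    using minus_log_convex[of "exp 1"] by (simp add: log_exp_one)
  then have "- ln (\<integral>\<theta>. ?g \<theta> \<partial>Q) \<le> (\<integral>\<theta>. - ln (?g \<theta>) \<partial>Q)"
    using risk_factor_ge_one
    by (intro Q.jensens_inequality[where I = "{0<..}"] int ln_int integrable_minus AE_I2)
      (fastforce simp: space_Q)+
  then show "(\<integral>\<theta>. ln (?g \<theta>) \<partial>Q) \<le> ln (1 - lam * risk \<nu> K p (pac_policy f Q))"
    by (simp add: mean)
qed

lemma ln_likelihood:
  assumes D: "D \<in> space (logged_data n \<nu> K \<pi>0 p)" and \<theta>: "\<theta> \<in> space T"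
  shows "0 < likelihood n D \<theta>"
    and "ln (likelihood n D \<theta>) = (\<Sum>i\<in>{1..n}. ln (loss_weight lam (f \<theta>) (D i)))
      - n * ln (1 - lam * predictor_risk (f \<theta>))"
proof -
  have pos: "0 < loss_weight lam (f \<theta>) (D i)" "0 < 1 - lam * predictor_risk (f \<theta>)" if "i \<in> {1..n}" for i
    using loss_weight_ge_one[OF log_sample[OF D that], of "f \<theta>"] risk_factor_ge_one[OF \<theta>] by auto
  then have ratio: "0 < loss_weight lam (f \<theta>) (D i) / (1 - lam * predictor_risk (f \<theta>))"
    if "i \<in> {1..n}" for i
    using that by (intro divide_pos_pos)
  then show "0 < likelihood n D \<theta>"
    unfolding likelihood_def by (rule prod_pos)
  have "ln (likelihood n D \<theta>)
      = (\<Sum>i\<in>{1..n}. ln (loss_weight lam (f \<theta>) (D i) / (1 - lam * predictor_risk (f \<theta>))))"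
    unfolding likelihood_def by (intro ln_prod finite_atLeastAtMost less_imp_neq[THEN not_sym] ratio)
  also have "\<dots> = (\<Sum>i\<in>{1..n}. ln (loss_weight lam (f \<theta>) (D i)) - ln (1 - lam * predictor_risk (f \<theta>)))"
    by (intro sum.cong refl ln_divide_pos pos)
  finally show "ln (likelihood n D \<theta>) = (\<Sum>i\<in>{1..n}. ln (loss_weight lam (f \<theta>) (D i)))
      - n * ln (1 - lam * predictor_risk (f \<theta>))"
    by (simp add: sum_subtractf)
qed

text \<open>The data terms average exactly to a multiple of the estimator; only the risk term loses
  something, through Jensen's inequality.\<close>

lemma integral_ln_likelihood:
  assumes D: "D \<in> space (logged_data n \<nu> K \<pi>0 p)" and Q: "Q \<in> space (prob_algebra T)" and "0 < n"
  shows "integrable Q (\<lambda>\<theta>. ln (likelihood n D \<theta>))"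
    and "- lam * n * R_lin lam n \<pi>0 D (pac_policy f Q) - n * ln (1 - lam * risk \<nu> K p (pac_policy f Q))
      \<le> (\<integral>\<theta>. ln (likelihood n D \<theta>) \<partial>Q)"
proof -
  let ?ell = "\<lambda>\<theta>. (\<Sum>i\<in>{1..n}. ln (loss_weight lam (f \<theta>) (D i)))
      - n * ln (1 - lam * predictor_risk (f \<theta>))"
  have "sets Q = sets T"
    using Q by (simp add: space_prob_algebra)
  then have space_Q: "space Q = space T"
    by (rule sets_eq_imp_space_eq)
  have term_int: "integrable Q (\<lambda>\<theta>. ln (loss_weight lam (f \<theta>) (D i)))"
    and term_val: "(\<integral>\<theta>. ln (loss_weight lam (f \<theta>) (D i)) \<partial>Q)
      = (case D i of (x, a, c) \<Rightarrow> pac_policy f Q x a * ln (1 - lam * c / \<pi>0 x a))"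
    if "i \<in> {1..n}" for i
    using log_sample[OF D that] integral_ln_loss_weight[OF Q]
    by (cases "D i"; simp add: space_pair_measure)+
  have int: "integrable Q ?ell"
    using term_int integral_ln_risk_factor(1)[OF Q] by (intro Bochner_Integration.integrable_diff Bochner_Integration.integrable_sum) auto
  have cong: "(\<integral>\<theta>. ln (likelihood n D \<theta>) \<partial>Q) = (\<integral>\<theta>. ?ell \<theta> \<partial>Q)"
    using ln_likelihood(2)[OF D] by (intro Bochner_Integration.integral_cong refl) (simp add: space_Q)
  show "integrable Q (\<lambda>\<theta>. ln (likelihood n D \<theta>))"
    using ln_likelihood(2)[OF D] int by (subst Bochner_Integration.integrable_cong[OF refl]) (auto simp: space_Q)
  \<comment> \<open>The factor \<open>- lam * n\<close> cancels the \<open>- (1 / n)\<close> and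
    \<open>1 / lam\<close> inside \<open>R_lin\<close>; both cancellations use positivity.\<close>
  have "- lam * n * R_lin lam n \<pi>0 D (pac_policy f Q)
      = (\<Sum>i\<in>{1..n}. \<integral>\<theta>. ln (loss_weight lam (f \<theta>) (D i)) \<partial>Q)"
    unfolding R_lin_def using \<open>0 < n\<close> lam_pos term_val
    by (auto simp: sum_distrib_left split_beta intro!: sum.cong)
  also have "\<dots> = (\<integral>\<theta>. ?ell \<theta> \<partial>Q) + n * (\<integral>\<theta>. ln (1 - lam * predictor_risk (f \<theta>)) \<partial>Q)"
    using term_int integral_ln_risk_factor(1)[OF Q]
    by (subst Bochner_Integration.integral_diff) (auto simp: Bochner_Integration.integral_sum)
  also have "\<dots> \<le> (\<integral>\<theta>. ?ell \<theta> \<partial>Q) + n * ln (1 - lam * risk \<nu> K p (pac_policy f Q))"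
    using integral_ln_risk_factor(3)[OF Q] by (intro add_left_mono mult_left_mono) auto
  finally show "- lam * n * R_lin lam n \<pi>0 D (pac_policy f Q)
      - n * ln (1 - lam * risk \<nu> K p (pac_policy f Q)) \<le> (\<integral>\<theta>. ln (likelihood n D \<theta>) \<partial>Q)"
    by (simp add: cong)
qed

section \<open>The pathwise risk bound on the event\<close>

lemma pac_bayes_bound:
  assumes P: "P \<in> space (prob_algebra T)" and Q: "Q \<in> space (prob_algebra T)"
    and "0 < n" "0 < \<delta>" and "D \<in> likelihood_event n P \<delta>"
  shows "ereal (risk \<nu> K p (pac_policy f Q))
    \<le> psi lam (ereal (R_lin lam n \<pi>0 D (pac_policy f Q))
        + (KL Q P + ereal (ln (1 / \<delta>))) / ereal (lam * real n))"
proof (cases "absolutely_continuous P Q \<and> integrable Q (entropy_density (exp 1) P Q)")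
  case True
  have D: "D \<in> space (logged_data n \<nu> K \<pi>0 p)"
    and Z: "(\<integral>\<^sup>+\<theta>. ennreal (likelihood n D \<theta>) \<partial>P) \<le> ennreal (1 / \<delta>)"
    using \<open>D \<in> likelihood_event n P \<delta>\<close> by (auto simp: likelihood_event_def)
  let ?R = "risk \<nu> K p (pac_policy f Q)"
  let ?b = "R_lin lam n \<pi>0 D (pac_policy f Q) + (KL_divergence (exp 1) P Q + ln (1 / \<delta>)) / (lam * n)"
  have sets_P: "sets P = sets T"
    using P by (simp add: space_prob_algebra)
  have "likelihood n D \<in> borel_measurable P"
    using measurable_compose[OF measurable_Pair1' likelihood_measurable, of D n] D
    by (subst measurable_cong_sets[OF sets_P refl]) simp
  \<comment> \<open>Change of measure with \<open>h = likelihood n D\<close> and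
    \<open>C = 1 / \<delta>\<close>; the event supplies the bound on the
    \<open>P\<close>-integral.\<close>
  then have "(\<integral>\<theta>. ln (likelihood n D \<theta>) \<partial>Q) \<le> KL_divergence (exp 1) P Q + ln (1 / \<delta>)"
    using True P Q Z \<open>0 < \<delta>\<close> integral_ln_likelihood(1)[OF D Q \<open>0 < n\<close>] ln_likelihood(1)[OF D]
      sets_eq_imp_space_eq[OF sets_P]
    by (intro change_of_measure_inequality) (auto simp: space_prob_algebra)
  with integral_ln_likelihood(2)[OF D Q \<open>0 < n\<close>]
  have "- lam * n * R_lin lam n \<pi>0 D (pac_policy f Q) - n * ln (1 - lam * ?R)
      \<le> KL_divergence (exp 1) P Q + ln (1 / \<delta>)"
    by (rule order_trans)
  \<comment> \<open>Clears the denominator in \<open>?b\<close>, so that the preceding inequality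
    becomes a comparison of \<open>- (lam * ?b)\<close> with \<open>ln (1 - lam * ?R)\<close>, both
    scaled by \<open>n\<close>.\<close>
  moreover have "n * (lam * (r + B / (lam * n))) = lam * n * r + B" for r B
    using \<open>0 < n\<close> lam_pos by (simp add: field_simps)
  ultimately have "n * - (lam * ?b) \<le> n * ln (1 - lam * ?R)"
    by (simp only: mult_minus_right)
  then have "- (lam * ?b) \<le> ln (1 - lam * ?R)"
    using \<open>0 < n\<close> by (subst (asm) mult_le_cancel_left_pos) simp_all
  then have "exp (- (lam * ?b)) \<le> 1 - lam * ?R"
    using integral_ln_risk_factor(2)[OF Q] by (simp add: ln_ge_iff)
  \<comment> \<open>Solving for \<open>?R\<close> produces exactly \<open>psi lam\<close> at
    \<open>?b\<close>.\<close>
  then have "?R \<le> 1 / lam * (1 - exp (- lam * ?b))"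
    using lam_pos by (simp add: field_simps)
  then show ?thesis
    using True \<open>0 < n\<close> lam_pos by (simp add: KL_def)
next
  \<comment> \<open>Here \<open>KL Q P\<close> is infinite, so the argument of \<open>psi\<close> is
    infinite and the bound reads \<open>1 / lam\<close>. It holds because costs are nonpositive and
    hence so is the risk.\<close>
  case False
  interpret Q: prob_space Q
    using Q by (simp add: space_prob_algebra)
  have "space Q = space T"
    using Q by (intro sets_eq_imp_space_eq) (simp add: space_prob_algebra)
  then have "risk \<nu> K p (pac_policy f Q) \<le> 0"
    unfolding risk_pac_policy(2)[OF Q] using predictor_risk_nonpos predictor_section
    by (intro Q.integral_le_const risk_pac_policy(1)[OF Q] AE_I2) auto
  then have "risk \<nu> K p (pac_policy f Q) \<le> 1 / lam"
    using lam_pos by (simp add: order_trans[of _ 0])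
  moreover have "0 < lam * real n"
    using \<open>0 < n\<close> lam_pos by simp
  ultimately show ?thesis
    using False by (auto simp: KL_def psi.simps(2)[folded infinity_ereal_def])
qed

end

theorem proposition10:
  fixes X :: "(real ^ 'd) set"
    and \<nu> :: "(real ^ 'd) measure"
    and K n :: nat
    and \<pi>0 :: "real ^ 'd \<Rightarrow> nat \<Rightarrow> real"
    and p :: "real ^ 'd \<Rightarrow> nat \<Rightarrow> real measure"
    and T P :: "'t measure"
    and f :: "'t \<Rightarrow> real ^ 'd \<Rightarrow> nat"
    and \<delta> lam :: real
  assumes "compact X"
    and "\<nu> \<in> space (prob_algebra (restrict_space borel X))"
    and "is_policy (restrict_space borel X) K \<pi>0"
    and "(\<lambda>(x, a). p x a)
           \<in> restrict_space borel X \<Otimes>\<^sub>M count_space {1..K} \<rightarrow>\<^sub>M prob_algebra cost_space"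
    and "(\<lambda>(\<theta>, x). f \<theta> x) \<in> T \<Otimes>\<^sub>M restrict_space borel X \<rightarrow>\<^sub>M count_space {1..K}"
    and "P \<in> space (prob_algebra T)"
    and "n \<ge> 1"
    and "0 < \<delta>" and "\<delta> \<le> 1"
    and "lam > 0"
  shows "\<exists>E \<in> sets (logged_data n \<nu> K \<pi>0 p).
           measure (logged_data n \<nu> K \<pi>0 p) E \<ge> 1 - \<delta> \<and>
           (\<forall>D\<in>E. \<forall>Q \<in> space (prob_algebra T).
              ereal (risk \<nu> K p (pac_policy f Q))
                \<le> psi lam (ereal (R_lin lam n \<pi>0 D (pac_policy f Q))
                            + (KL Q P + ereal (ln (1 / \<delta>))) / ereal (lam * real n)))"
proof -
  have sets_eq: "sets \<nu> = sets (restrict_space borel X)" and "prob_space \<nu>"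
    using assms(2) by (auto simp: space_prob_algebra)
  interpret prob_space \<nu> by fact
  \<comment> \<open>The hypotheses are stated over the Borel sets of \<open>X\<close>. They transfer
    to \<open>\<nu>\<close> because measurability depends only on the underlying sigma-algebra,
    which is the same.\<close>
  have "is_policy \<nu> K \<pi>0"
    using assms(3)
    by (simp add: is_policy_def sets_eq_imp_space_eq[OF sets_eq]
        measurable_cong_sets[OF sets_eq refl, of "borel :: real measure"])
  moreover have "(\<lambda>(x, a). p x a) \<in> \<nu> \<Otimes>\<^sub>M count_space {1..K} \<rightarrow>\<^sub>M prob_algebra cost_space"
    using assms(4) measurable_cong_sets[OF sets_pair_measure_cong[OF sets_eq refl] refl] by blast
  moreover have "(\<lambda>(\<theta>, x). f \<theta> x) \<in> T \<Otimes>\<^sub>M \<nu> \<rightarrow>\<^sub>M count_space {1..K}"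
    using assms(5) measurable_cong_sets[OF sets_pair_measure_cong[OF refl sets_eq] refl] by blast
  ultimately interpret pac_bayes_bandit \<nu> K \<pi>0 p T f lam
    using \<open>lam > 0\<close> by unfold_locales
  \<comment> \<open>The witness is \<open>likelihood_event n P \<delta>\<close>, fixed before any
    \<open>D\<close> or \<open>Q\<close> is chosen.\<close>
  show ?thesis
    using likelihood_event_prob[OF \<open>P \<in> space (prob_algebra T)\<close> \<open>0 < \<delta>\<close>, of n]
      pac_bayes_bound[OF \<open>P \<in> space (prob_algebra T)\<close>] \<open>n \<ge> 1\<close> \<open>0 < \<delta>\<close>
    by (intro bexI[of _ "likelihood_event n P \<delta>"]) auto
qed

end
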